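(* Let $(e_i)$ be a normalized, bimonotone, $1$-spreading basis for a Banach space $X$. Let $(\sigma_j)_{j=1}^\infty$ be a partition of $\mathbb{N}$ into successive (finite) intervals $\sigma_1<\sigma_2<\cdots$, with $|\sigma_j|=n_j$ for $j\in\mathbb{N}$. Then the averaging operator $$Q\Big(\sum_i a_i e_i\Big)=\sum_{j=1}^\infty\Big(\frac{1}{n_j}\sum_{i\in\sigma_j}a_i\Big)\Big(\sum_{i\in\sigma_j}e_i\Big)$$ is a bounded projection on $X$ with $\|Q\|\le 3$.
   Context: A basic sequence $(e_i)$ is $1$-spreading if $\|\sum_i a_i e_i\|=\|\sum_i a_i e_{n_i}\|$ for all finitely supported scalars $(a_i)$ and all $n_1<n_2<\cdots$. A basis is bimonotone if all projections $\sum_i a_i e_i\mapsto\sum_{i\in I}a_i e_i$, for intervals $I\subseteq\mathbb{N}$, have norm at most $1$. *)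

theory Defs
  imports "HOL-Analysis.Analysis"
begin

text \<open>
  The scalar field is a type of class \<open>real_normed_field\<close>, so that real and complex Banach
  spaces are treated uniformly: by Mazur's theorem the members of this class are exactly the
  real and the complex field, up to isometric isomorphism.  The library's class
  \<open>banach\<close> supplies the complete norm; the locale adds a scalar multiplication
  that extends the built-in real one and for which the norm is homogeneous.
\<close>

locale normed_scaling = vector_space smul
  for smul :: "'k::real_normed_field \<Rightarrow> 'a::real_normed_vector \<Rightarrow> 'a" +
  assumes scale_of_real: "smul (of_real r) x = r *\<^sub>R x"
    and norm_scale: "norm (smul c x) = norm c * norm x"

lemma normed_scaling_scaleR: "normed_scaling (scaleR :: real \<Rightarrow> 'a::real_normed_vector \<Rightarrow> 'a)"
  by unfold_locales (auto simp: algebra_simps)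

lemma normed_scaling_complex: "normed_scaling ((*) :: complex \<Rightarrow> complex \<Rightarrow> complex)"
  by unfold_locales (auto simp: algebra_simps norm_mult scaleR_conv_of_real)

definition schauder_basis :: "('k::real_normed_field \<Rightarrow> 'a::real_normed_vector \<Rightarrow> 'a) \<Rightarrow> (nat \<Rightarrow> 'a) \<Rightarrow> bool"
  where "schauder_basis smul e \<longleftrightarrow> (\<forall>x. \<exists>!a. (\<lambda>i. smul (a i) (e i)) sums x)"

definition basis_coeff :: "('k::real_normed_field \<Rightarrow> 'a::real_normed_vector \<Rightarrow> 'a) \<Rightarrow> (nat \<Rightarrow> 'a) \<Rightarrow> 'a \<Rightarrow> nat \<Rightarrow> 'k"
  where "basis_coeff smul e x = (THE a. (\<lambda>i. smul (a i) (e i)) sums x)"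

definition normalized :: "(nat \<Rightarrow> 'a::real_normed_vector) \<Rightarrow> bool"
  where "normalized e \<longleftrightarrow> (\<forall>i. norm (e i) = 1)"

definition one_spreading :: "('k::real_normed_field \<Rightarrow> 'a::real_normed_vector \<Rightarrow> 'a) \<Rightarrow> (nat \<Rightarrow> 'a) \<Rightarrow> bool"
  where "one_spreading smul e \<longleftrightarrow>
    (\<forall>(a :: nat \<Rightarrow> 'k) (n :: nat \<Rightarrow> nat). finite {i. a i \<noteq> 0} \<longrightarrow> strict_mono n \<longrightarrow>
      norm (\<Sum>i | a i \<noteq> 0. smul (a i) (e i)) = norm (\<Sum>i | a i \<noteq> 0. smul (a i) (e (n i))))"

text \<open>Intervals of natural numbers may be finite or infinite.\<close>

definition nat_interval :: "nat set \<Rightarrow> bool"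
  where "nat_interval I \<longleftrightarrow> (\<forall>i\<in>I. \<forall>k\<in>I. {i..k} \<subseteq> I)"

text \<open>For a basis and an interval \<open>I\<close> the series below always converges.\<close>

definition basis_proj :: "('k::real_normed_field \<Rightarrow> 'a::real_normed_vector \<Rightarrow> 'a) \<Rightarrow> (nat \<Rightarrow> 'a) \<Rightarrow> nat set \<Rightarrow> 'a \<Rightarrow> 'a"
  where "basis_proj smul e I x = (\<Sum>i. if i \<in> I then smul (basis_coeff smul e x i) (e i) else 0)"

text \<open>\<open>onorm\<close> is meaningful only for bounded operators, so boundedness is stated along with it.\<close>

definition bimonotone :: "('k::real_normed_field \<Rightarrow> 'a::real_normed_vector \<Rightarrow> 'a) \<Rightarrow> (nat \<Rightarrow> 'a) \<Rightarrow> bool"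
  where "bimonotone smul e \<longleftrightarrow>
    (\<forall>I. nat_interval I \<longrightarrow> bounded_linear (basis_proj smul e I) \<and> onorm (basis_proj smul e I) \<le> 1)"

definition successive_interval_partition :: "(nat \<Rightarrow> nat set) \<Rightarrow> bool"
  where "successive_interval_partition \<sigma> \<longleftrightarrow>
    (\<forall>j. finite (\<sigma> j) \<and> \<sigma> j \<noteq> {} \<and> nat_interval (\<sigma> j)) \<and>
    (\<forall>j l. j < l \<longrightarrow> (\<forall>i\<in>\<sigma> j. \<forall>k\<in>\<sigma> l. i < k)) \<and>
    (\<Union>j. \<sigma> j) = UNIV"

definition averaging_term ::
  "('k::real_normed_field \<Rightarrow> 'a::real_normed_vector \<Rightarrow> 'a) \<Rightarrow> (nat \<Rightarrow> 'a) \<Rightarrow> (nat \<Rightarrow> nat set) \<Rightarrow> (nat \<Rightarrow> nat) \<Rightarrow> 'a \<Rightarrow> nat \<Rightarrow> 'a"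
  where "averaging_term smul e \<sigma> n x j =
    smul (1 / of_nat (n j) * (\<Sum>i\<in>\<sigma> j. basis_coeff smul e x i)) (\<Sum>i\<in>\<sigma> j. e i)"

definition averaging_op ::
  "('k::real_normed_field \<Rightarrow> 'a::real_normed_vector \<Rightarrow> 'a) \<Rightarrow> (nat \<Rightarrow> 'a) \<Rightarrow> (nat \<Rightarrow> nat set) \<Rightarrow> (nat \<Rightarrow> nat) \<Rightarrow> 'a \<Rightarrow> 'a"
  where "averaging_op smul e \<sigma> n x = (\<Sum>j. averaging_term smul e \<sigma> n x j)"

text \<open>\<open>bounded_linear\<close> is about real scalars; linearity over the scalar field is stated separately.\<close>

definition bounded_projection :: "('k::real_normed_field \<Rightarrow> 'a::real_normed_vector \<Rightarrow> 'a) \<Rightarrow> ('a \<Rightarrow> 'a) \<Rightarrow> bool"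
  where "bounded_projection smul P \<longleftrightarrow>
    Vector_Spaces.linear smul smul P \<and> bounded_linear P \<and> P \<circ> P = P"

end

theory Submission
  imports Defs
begin

text \<open>
  Let \<open>x\<close> be finitely supported.  Give each block, of length \<open>n\<close>, a room of \<open>3 n\<close> consecutive
  positions and move its entry at offset \<open>r\<close> to the offset \<open>r + t\<close>, to \<open>n + r + t\<close>, or to the former
  if \<open>r + t < n\<close> and to the latter otherwise, where \<open>0 \<le> t < n\<close>.  All three moves are
  increasing, so they preserve the norm of \<open>x\<close>; and the first two vectors minus the third is the
  vector whose blocks are those of \<open>x\<close>, rotated cyclically by \<open>t\<close> and placed in the middle third.
  Hence blockwise rotation, with a different amount in each block, enlarges norms at most by the
  factor 3.  Rotating every block by \<open>k\<close> modulo its length and averaging over \<open>k\<close> below a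
  common multiple of the lengths gives \<open>Q x\<close>.
\<close>

section \<open>Partitions into successive intervals\<close>

text \<open>Joint induction on \<open>j\<close>. If the earlier blocks fill exactly the numbers
  below \<open>p j\<close>, the block containing \<open>p j\<close> is not an earlier one; nor is it
  a later one, since \<open>\<sigma> j\<close> is nonempty and has no element below
  \<open>p j\<close>. So \<open>\<sigma> j\<close> starts at \<open>p j\<close>.\<close>

lemma successive_interval_partition_unions:
  fixes \<sigma> :: "nat \<Rightarrow> nat set"
  assumes part: "successive_interval_partition \<sigma>"
  defines "p \<equiv> \<lambda>j. \<Sum>l<j. card (\<sigma> l)"
  shows "\<sigma> j = {p j..<p (Suc j)} \<and> (\<Union>l<j. \<sigma> l) = {..<p j}"
proof -
  have fin: "finite (\<sigma> j)" and ne: "\<sigma> j \<noteq> {}" and int: "nat_interval (\<sigma> j)" for j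
    using part by (auto simp: successive_interval_partition_def)
  have less: "i < k" if "j < l" "i \<in> \<sigma> j" "k \<in> \<sigma> l" for i k j l
    using part that by (auto simp: successive_interval_partition_def)
  have cover: "\<exists>l. i \<in> \<sigma> l" for i
    using part by (auto simp: successive_interval_partition_def)
  have block: "\<sigma> j = {p j..<p (Suc j)}" if un: "(\<Union>l<j. \<sigma> l) = {..<p j}" for j
  proof -
    have ge: "p j \<le> i" if "i \<in> \<sigma> j" for i
    proof (rule ccontr)
      assume "\<not> p j \<le> i"
      then have "i \<in> (\<Union>l<j. \<sigma> l)" using un by auto
      then show False using less that by blast
    qed
    obtain l where l: "p j \<in> \<sigma> l" using cover by blast
    have "\<not> l < j" using l un by auto
    moreover have "\<not> j < l" using less[of j l _ "p j"] l ge ne[of j] by (meson all_not_in_conv leD)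
    ultimately have "p j \<in> \<sigma> j" using l by (metis nat_neq_iff)
    moreover have "Max (\<sigma> j) \<in> \<sigma> j" using fin ne by simp
    ultimately have "{p j..Max (\<sigma> j)} \<subseteq> \<sigma> j" using int[of j] by (auto simp: nat_interval_def)
    then have eq: "\<sigma> j = {p j..Max (\<sigma> j)}" using ge fin[of j] by auto
    have "p j \<le> Max (\<sigma> j)" using ge \<open>Max (\<sigma> j) \<in> \<sigma> j\<close> by blast
    moreover have "card (\<sigma> j) = Suc (Max (\<sigma> j)) - p j" by (subst eq) simp
    ultimately have "p (Suc j) = Suc (Max (\<sigma> j))" by (simp add: p_def)
    then show ?thesis using eq by (metis atLeastLessThanSuc_atLeastAtMost)
  qed
  have "(\<Union>l<j. \<sigma> l) = {..<p j}" for j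
  proof (induction j)
    case 0
    show ?case by (simp add: p_def)
  next
    case (Suc j)
    have "p j \<le> p (Suc j)" by (simp add: p_def)
    then show ?case using Suc block[OF Suc] by (auto simp: lessThan_Suc)
  qed
  then show ?thesis by (intro conjI block)
qed

locale nat_blocks =
  fixes p :: "nat \<Rightarrow> nat"
  assumes p_0: "p 0 = 0" and strict_mono_p: "strict_mono p"
begin

definition block :: "nat \<Rightarrow> nat set"
  where "block j = {p j..<p (Suc j)}"

definition width :: "nat \<Rightarrow> nat"
  where "width j = p (Suc j) - p j"

definition idx :: "nat \<Rightarrow> nat"
  where "idx i = (LEAST j. i < p (Suc j))"

lemma p_less_Suc: "p j < p (Suc j)"
  using strict_mono_p by (simp add: strict_mono_Suc_iff)

lemma width_pos: "0 < width j"
  using p_less_Suc[of j] by (simp add: width_def)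

lemma p_Suc: "p (Suc j) = p j + width j"
  using p_less_Suc[of j] by (simp add: width_def)

lemma finite_block [simp]: "finite (block j)"
  by (simp add: block_def)

lemma block_eq_image: "block j = (+) (p j) ` {..<width j}"
  by (simp add: block_def p_Suc lessThan_atLeast0 add.commute)

lemma sum_block: "sum f (block j) = (\<Sum>t<width j. f (p j + t))"
  by (simp add: block_eq_image sum.reindex)

lemma idx_eq:
  assumes "i \<in> block j"
  shows "idx i = j"
  unfolding idx_def
proof (rule Least_equality)
  show "i < p (Suc j)" using assms by (simp add: block_def)
  show "j \<le> l" if "i < p (Suc l)" for l
  proof (rule ccontr)
    assume "\<not> j \<le> l"
    then have "p (Suc l) \<le> p j" using strict_mono_p by (simp add: strict_mono_less_eq)
    then show False using that assms by (simp add: block_def)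
  qed
qed

lemma mem_block_idx: "i \<in> block (idx i)"
proof -
  \<comment> \<open>A strictly increasing sequence of naturals satisfies \<open>m \<le> p m\<close>,
    so the \<open>LEAST\<close> in \<open>idx\<close> is attained.\<close>
  have "i < p (Suc i)"
    using strict_mono_imp_increasing[OF strict_mono_p, of "Suc i"] by simp
  then have upper: "i < p (Suc (idx i))" unfolding idx_def by (rule LeastI)
  have "p (idx i) \<le> i"
  proof (cases "idx i")
    case 0
    then show ?thesis by (simp add: p_0)
  next
    case (Suc l)
    then have "\<not> i < p (Suc l)" unfolding idx_def by (metis lessI not_less_Least)
    then show ?thesis using Suc by simp
  qed
  then show ?thesis using upper by (simp add: block_def)
qed

lemma block_disjoint: "j \<noteq> l \<Longrightarrow> block j \<inter> block l = {}"
  using idx_eq by blast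

lemma UN_block_lessThan: "(\<Union>j<m. block j) = {..<p m}"
proof (induction m)
  case 0
  show ?case by (simp add: p_0)
next
  case (Suc m)
  then show ?case using p_less_Suc[of m] by (auto simp: lessThan_Suc block_def)
qed

lemma idx_mono: "i \<le> k \<Longrightarrow> idx i \<le> idx k"
  using mem_block_idx[of k] unfolding idx_def[of i]
  by (intro Least_le) (simp add: block_def)

text \<open>The room of block \<open>j\<close> runs from \<open>3 * p j\<close> up to, but
  excluding, \<open>3 * p (Suc j)\<close>. Rooms are disjoint and ordered like the blocks, so
  monotonicity only has to be checked inside one room.\<close>

lemma strict_mono_rooms:
  assumes mono: "\<And>i k. i < k \<Longrightarrow> idx i = idx k \<Longrightarrow> g i < g k"
    and bound: "\<And>i. g i < 3 * width (idx i)"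
  shows "strict_mono (\<lambda>i. 3 * p (idx i) + g i)"
proof (rule strict_monoI)
  fix i k :: nat
  assume "i < k"
  show "3 * p (idx i) + g i < 3 * p (idx k) + g k"
  proof (cases "idx i = idx k")
    case True
    then show ?thesis using mono[OF \<open>i < k\<close>] by simp
  next
    case False
    then have "Suc (idx i) \<le> idx k" using idx_mono[of i k] \<open>i < k\<close> by simp
    then have "p (Suc (idx i)) \<le> p (idx k)" using strict_mono_p by (simp add: strict_mono_less_eq)
    then show ?thesis using bound[of i] by (simp add: p_Suc)
  qed
qed

end

section \<open>Rotations and averages\<close>

text \<open>Advancing the start by one drops the term at \<open>r mod n\<close> and gains the one at
  \<open>(r + n) mod n\<close>, which is the same.\<close>

lemma sum_rotate:
  fixes f :: "nat \<Rightarrow> 'b::ab_group_add"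
  shows "(\<Sum>t<n. f ((r + t) mod n)) = (\<Sum>t<n. f t)"
proof (induction r)
  case 0
  show ?case by simp
next
  case (Suc r)
  have "f (r mod n) + (\<Sum>t<n. f ((Suc r + t) mod n)) = (\<Sum>t<Suc n. f ((r + t) mod n))"
    by (subst sum.lessThan_Suc_shift) simp
  also have "\<dots> = f (r mod n) + (\<Sum>t<n. f ((r + t) mod n))" by simp
  finally show ?case using Suc by simp
qed

text \<open>The range splits into \<open>m\<close> runs of length \<open>n\<close>, each a full
  turn. This allows one range of \<open>k\<close> to serve blocks of different lengths.\<close>

lemma sum_rotate_multiple:
  fixes f :: "nat \<Rightarrow> 'b::real_vector"
  shows "(\<Sum>k<m * n. f ((r + k) mod n)) = real m *\<^sub>R (\<Sum>t<n. f t)"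
proof -
  have "(\<Sum>k<m * n. f ((r + k) mod n)) = (\<Sum>l<m. \<Sum>k\<in>{l * n..<l * n + n}. f ((r + k) mod n))"
    by (rule sum.nat_group[symmetric])
  also have "\<dots> = (\<Sum>l<m. \<Sum>t<n. f ((r + t) mod n))"
  proof (rule sum.cong[OF refl])
    fix l
    have "(\<Sum>k\<in>{l * n..<l * n + n}. f ((r + k) mod n)) = (\<Sum>t<n. f ((r + (t + l * n)) mod n))"
      using sum.shift_bounds_nat_ivl[of "\<lambda>k. f ((r + k) mod n)" 0 "l * n" n]
      by (simp add: lessThan_atLeast0 add.commute)
    then show "(\<Sum>k\<in>{l * n..<l * n + n}. f ((r + k) mod n)) = (\<Sum>t<n. f ((r + t) mod n))"
      by (simp flip: add.assoc)
  qed
  finally show ?thesis by (simp add: sum_rotate sum_constant_scaleR)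
qed

text \<open>The definition sums over the exact support. Cutting \<open>a\<close> off outside
  \<open>S\<close> makes the support finite, and indices in \<open>S\<close> with coefficient 0
  contribute to neither sum.\<close>

lemma one_spreading_norm:
  assumes "vector_space smul" "one_spreading smul e" "finite S" "strict_mono \<phi>"
  shows "norm (\<Sum>i\<in>S. smul (a i) (e (\<phi> i))) = norm (\<Sum>i\<in>S. smul (a i) (e i))"
proof -
  interpret vector_space smul by fact
  define b where "b i = (if i \<in> S then a i else 0)" for i
  have sub: "{i. b i \<noteq> 0} \<subseteq> S" by (auto simp: b_def)
  have restrict: "(\<Sum>i\<in>S. smul (a i) (f i)) = (\<Sum>i | b i \<noteq> 0. smul (b i) (f i))" for f
    by (rule sum.mono_neutral_cong_right) (use sub \<open>finite S\<close> in \<open>auto simp: b_def\<close>)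
  show ?thesis
    unfolding restrict
    by (rule assms(2)[unfolded one_spreading_def, rule_format, symmetric])
      (use assms(4) finite_subset[OF sub \<open>finite S\<close>] in auto)
qed

locale spreading_blocks = nat_blocks p + normed_scaling smul
  for p :: "nat \<Rightarrow> nat" and smul :: "'k::real_normed_field \<Rightarrow> 'a::real_normed_vector \<Rightarrow> 'a" +
  fixes e :: "nat \<Rightarrow> 'a"
  assumes spreading: "one_spreading smul e"
begin

definition middle :: "nat \<Rightarrow> nat"
  where "middle i = 3 * p (idx i) + (width (idx i) + (i - p (idx i)))"

text \<open>A single \<open>k\<close> turns all blocks at once, each by its own amount
  \<open>k\<close> modulo its width.\<close>

definition rotate :: "nat \<Rightarrow> nat \<Rightarrow> nat"
  where "rotate k i = p (idx i) + (i - p (idx i) + k) mod width (idx i)"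

lemmas norm_spread = one_spreading_norm[OF vector_space_axioms spreading]

lemma strict_mono_middle: "strict_mono middle"
  unfolding middle_def
proof (rule strict_mono_rooms)
  fix i k :: nat
  show "width (idx i) + (i - p (idx i)) < width (idx k) + (k - p (idx k))" if "i < k" "idx i = idx k"
    using that mem_block_idx[of i] by (auto simp: block_def)
  show "width (idx i) + (i - p (idx i)) < 3 * width (idx i)"
    using mem_block_idx[of i] by (auto simp: block_def p_Suc)
qed

lemma norm_rotate_le:
  assumes "finite S"
  shows "norm (\<Sum>i\<in>S. smul (a i) (e (middle (rotate k i)))) \<le> 3 * norm (\<Sum>i\<in>S. smul (a i) (e i))"
proof -
  \<comment> \<open>The target offset before wrapping round: both summands are below the width, so
    at most one width has to be subtracted.\<close>
  define g where "g i = i - p (idx i) + k mod width (idx i)" for i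
  define \<phi> where "\<phi> i = 3 * p (idx i) + (width (idx i) + g i)" for i
  define \<eta> where "\<eta> i = 3 * p (idx i) + g i" for i
  \<comment> \<open>The jump by one width occurs only at the larger values of \<open>g\<close>, so
    this move is increasing too.\<close>
  define \<psi> where "\<psi> i = 3 * p (idx i) + (if g i < width (idx i) then g i else width (idx i) + g i)" for i
  have g_less: "g i < 2 * width (idx i)" for i
    using mem_block_idx[of i] mod_less_divisor[OF width_pos, of k "idx i"]
    unfolding g_def block_def p_Suc atLeastLessThan_iff by linarith
  have g_mono: "g i < g k" if "i < k" "idx i = idx k" for i k
    using that mem_block_idx[of i] by (auto simp: block_def g_def)
  have "strict_mono \<phi>" unfolding \<phi>_def
  proof (rule strict_mono_rooms)
    fix i k :: nat
    show "width (idx i) + g i < width (idx k) + g k" if "i < k" "idx i = idx k"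
      using g_mono[OF that] that by simp
    show "width (idx i) + g i < 3 * width (idx i)" using g_less[of i] by simp
  qed
  moreover have "strict_mono \<eta>" unfolding \<eta>_def
  proof (rule strict_mono_rooms)
    show "g i < 3 * width (idx i)" for i using g_less[of i] by simp
  qed (rule g_mono)
  moreover have "strict_mono \<psi>" unfolding \<psi>_def
  proof (rule strict_mono_rooms)
    fix i k :: nat
    show "(if g i < width (idx i) then g i else width (idx i) + g i)
        < (if g k < width (idx k) then g k else width (idx k) + g k)" if "i < k" "idx i = idx k"
      using g_mono[OF that] that by auto
    show "(if g i < width (idx i) then g i else width (idx i) + g i) < 3 * width (idx i)"
      using g_less[of i] width_pos[of "idx i"] by auto
  qed
  \<comment> \<open>Without wrapping, \<open>\<eta>\<close> and \<open>\<psi>\<close> agree and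
    \<open>\<phi>\<close> remains; with wrapping, \<open>\<phi>\<close> and \<open>\<psi>\<close>
    agree and \<open>\<eta>\<close> remains. Either way the remaining position is in the middle
    third.\<close>
  moreover have "e (middle (rotate k i)) = e (\<phi> i) + e (\<eta> i) - e (\<psi> i)" for i
  proof -
    have "(i - p (idx i) + k) mod width (idx i) = g i mod width (idx i)"
      unfolding g_def by (simp add: mod_add_right_eq)
    also have "\<dots> = (if g i < width (idx i) then g i else g i - width (idx i))"
      using g_less[of i] by (simp add: le_mod_geq)
    finally have rot: "rotate k i = p (idx i) + (if g i < width (idx i) then g i else g i - width (idx i))"
      by (simp add: rotate_def)
    then have "rotate k i \<in> block (idx i)"
      using g_less[of i] by (auto simp: block_def p_Suc)
    then have "idx (rotate k i) = idx i" by (rule idx_eq)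
    then show ?thesis using rot by (auto simp: middle_def \<phi>_def \<eta>_def \<psi>_def)
  qed
  \<comment> \<open>Each of the three sums has the norm of the original one, whence the constant
    3.\<close>
  ultimately show ?thesis
    using norm_triangle_ineq4[of "(\<Sum>i\<in>S. smul (a i) (e (\<phi> i))) + (\<Sum>i\<in>S. smul (a i) (e (\<eta> i)))"
        "\<Sum>i\<in>S. smul (a i) (e (\<psi> i))"]
      norm_triangle_ineq[of "\<Sum>i\<in>S. smul (a i) (e (\<phi> i))" "\<Sum>i\<in>S. smul (a i) (e (\<eta> i))"]
      norm_spread[OF assms, of \<phi> a] norm_spread[OF assms, of \<eta> a] norm_spread[OF assms, of \<psi> a]
    by (simp add: scale_right_distrib scale_right_diff_distrib sum.distrib sum_subtractf)
qed

text \<open>Arbitrary finite \<open>J\<close> covers both the partial sums and the segments in the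
  Cauchy criterion.\<close>

lemma norm_averages_le:
  assumes "finite J"
  shows "norm (\<Sum>j\<in>J. smul (1 / of_nat (width j) * (\<Sum>i\<in>block j. a i)) (\<Sum>i\<in>block j. e i))
      \<le> 3 * norm (\<Sum>j\<in>J. \<Sum>i\<in>block j. smul (a i) (e i))"
proof -
  define S where "S = (\<Union>j\<in>J. block j)"
  \<comment> \<open>A common multiple of the finitely many lengths.\<close>
  define N where "N = (\<Prod>j\<in>J. width j)"
  define c where "c j = 1 / of_nat (width j) * (\<Sum>i\<in>block j. a i)" for j
  have finS: "finite S" using assms by (simp add: S_def)
  have sum_S: "sum f S = (\<Sum>j\<in>J. sum f (block j))" for f :: "nat \<Rightarrow> 'a"
    unfolding S_def by (rule sum.UNION_disjoint) (use assms block_disjoint in auto)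
  have N_pos: "N > 0" unfolding N_def by (rule prod_pos) (use width_pos in auto)
  \<comment> \<open>As \<open>k\<close> runs below \<open>N\<close>, an entry visits each position
    of its block \<open>N / width j\<close> times, wherever it started.\<close>
  have rot: "(\<Sum>k<N. e (middle (rotate k i)))
      = real N *\<^sub>R (1 / real (width j)) *\<^sub>R (\<Sum>l\<in>block j. e (middle l))"
    if "j \<in> J" "i \<in> block j" for i j
  proof -
    have "width j dvd N" unfolding N_def using that assms by (simp add: dvd_prodI)
    then obtain m where m: "N = m * width j" by (metis dvdE mult.commute)
    have "(\<Sum>k<N. e (middle (rotate k i))) = real m *\<^sub>R (\<Sum>t<width j. e (middle (p j + t)))"
      using sum_rotate_multiple[of "\<lambda>t. e (middle (p j + t))" "i - p j" "width j" m]
      unfolding m rotate_def idx_eq[OF that(2)] .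
    then show ?thesis using width_pos[of j] by (simp add: sum_block m)
  qed
  have block_avg: "(\<Sum>i\<in>block j. \<Sum>k<N. smul (a i) (e (middle (rotate k i))))
      = real N *\<^sub>R (\<Sum>l\<in>block j. smul (c j) (e (middle l)))" if "j \<in> J" for j
  proof -
    have "(\<Sum>i\<in>block j. \<Sum>k<N. smul (a i) (e (middle (rotate k i))))
        = (\<Sum>i\<in>block j. smul (a i) (real N *\<^sub>R (1 / real (width j)) *\<^sub>R (\<Sum>l\<in>block j. e (middle l))))"
      by (rule sum.cong[OF refl]) (simp add: rot[OF that] flip: scale_sum_right)
    also have "\<dots> = smul (\<Sum>i\<in>block j. a i)
        (real N *\<^sub>R (1 / real (width j)) *\<^sub>R (\<Sum>l\<in>block j. e (middle l)))"
      by (rule scale_sum_left[symmetric])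
    also have "\<dots> = real N *\<^sub>R smul (c j) (\<Sum>l\<in>block j. e (middle l))"
      by (simp add: c_def mult_ac flip: scale_of_real)
    finally show ?thesis by (simp add: scale_sum_right)
  qed
  have "real N * norm (\<Sum>j\<in>J. smul (c j) (\<Sum>i\<in>block j. e i))
      = real N * norm (\<Sum>i\<in>S. smul (c (idx i)) (e i))"
    by (simp add: sum_S scale_sum_right idx_eq cong: sum.cong)
  \<comment> \<open>Spreading carries the averaged vector to the middle thirds, where the rotated
    copies lie.\<close>
  also have "\<dots> = norm (real N *\<^sub>R (\<Sum>i\<in>S. smul (c (idx i)) (e (middle i))))"
    using norm_spread[OF finS strict_mono_middle, of "\<lambda>i. c (idx i)"] by simp
  also have "real N *\<^sub>R (\<Sum>i\<in>S. smul (c (idx i)) (e (middle i)))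
      = (\<Sum>j\<in>J. \<Sum>i\<in>block j. \<Sum>k<N. smul (a i) (e (middle (rotate k i))))"
    by (simp add: sum_S idx_eq block_avg scaleR_right.sum cong: sum.cong)
  also have "\<dots> = (\<Sum>k<N. \<Sum>i\<in>S. smul (a i) (e (middle (rotate k i))))"
    by (subst sum.swap) (simp add: sum_S)
  also have "norm \<dots> \<le> (\<Sum>k<N. 3 * norm (\<Sum>i\<in>S. smul (a i) (e i)))"
    by (rule sum_norm_le) (rule norm_rotate_le[OF finS])
  finally show ?thesis using N_pos by (simp add: sum_S c_def)
qed

end

section \<open>Coefficients of a Schauder basis\<close>

lemma sums_basis_coeff:
  assumes "schauder_basis smul e"
  shows "(\<lambda>i. smul (basis_coeff smul e x i) (e i)) sums x"
  unfolding basis_coeff_def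
  by (rule theI'[OF spec[OF assms[unfolded schauder_basis_def]]])

lemma basis_coeff_unique:
  assumes "schauder_basis smul e" "(\<lambda>i. smul (a i) (e i)) sums x"
  shows "basis_coeff smul e x = a"
  unfolding basis_coeff_def
  by (rule the1_equality) (use assms in \<open>simp_all only: schauder_basis_def\<close>)

text \<open>The sum of two convergent expansions is an expansion of \<open>x + y\<close>; uniqueness
  does the rest.\<close>

lemma basis_coeff_add:
  assumes "vector_space smul" "schauder_basis smul e"
  shows "basis_coeff smul e (x + y) i = basis_coeff smul e x i + basis_coeff smul e y i"
proof -
  interpret vector_space smul by fact
  have "basis_coeff smul e (x + y) = (\<lambda>i. basis_coeff smul e x i + basis_coeff smul e y i)"
    by (rule basis_coeff_unique[OF assms(2)])
      (simp add: scale_left_distrib sums_add sums_basis_coeff[OF assms(2)])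
  then show ?thesis by simp
qed

text \<open>Continuity lets a scalar pass through infinite sums.\<close>

lemma (in normed_scaling) bounded_linear_scale: "bounded_linear (smul c)"
proof (rule bounded_linear_intro[where K = "norm c"])
  show "smul c (r *\<^sub>R x) = r *\<^sub>R smul c x" for r x
    by (simp add: mult.commute flip: scale_of_real)
qed (simp_all add: scale_right_distrib norm_scale mult.commute)

lemma basis_coeff_scale:
  assumes "normed_scaling smul" "schauder_basis smul e"
  shows "basis_coeff smul e (smul c x) i = c * basis_coeff smul e x i"
proof -
  interpret normed_scaling smul by fact
  have "basis_coeff smul e (smul c x) = (\<lambda>i. c * basis_coeff smul e x i)"
    by (rule basis_coeff_unique[OF assms(2)])
      (use bounded_linear.sums[OF bounded_linear_scale sums_basis_coeff[OF assms(2)]] in simp)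
  then show ?thesis by simp
qed

lemma basis_coeff_sum:
  assumes "vector_space smul" "schauder_basis smul e" "finite S"
  shows "basis_coeff smul e (\<Sum>i\<in>S. e i) i = (if i \<in> S then 1 else 0)"
proof -
  interpret vector_space smul by fact
  have "(\<lambda>i. if i \<in> S then e i else 0) sums (\<Sum>i\<in>S. e i)"
    by (rule sums_If_finite_set) fact
  also have "(\<lambda>i. if i \<in> S then e i else 0) = (\<lambda>i. smul (if i \<in> S then 1 else 0) (e i))"
    by auto
  finally show ?thesis by (simp add: basis_coeff_unique[OF assms(2)])
qed

section \<open>The averaging projection\<close>

theorem theorem2p8:
  fixes smul :: "'k::real_normed_field \<Rightarrow> 'a::banach \<Rightarrow> 'a"
    and e :: "nat \<Rightarrow> 'a"
    and \<sigma> :: "nat \<Rightarrow> nat set"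
    and n :: "nat \<Rightarrow> nat"
  assumes "normed_scaling smul"
    and "schauder_basis smul e"
    and "normalized e"
    and "bimonotone smul e"
    and "one_spreading smul e"
    and "successive_interval_partition \<sigma>"
    and "\<And>j. card (\<sigma> j) = n j"
  shows "(\<forall>x. summable (averaging_term smul e \<sigma> n x)) \<and>
    bounded_projection smul (averaging_op smul e \<sigma> n) \<and>
    onorm (averaging_op smul e \<sigma> n) \<le> 3"
proof -
  interpret normed_scaling smul by fact
  note basis = assms(2)
  define p where "p j = (\<Sum>l<j. n l)" for j
  have \<sigma>_eq: "\<sigma> j = {p j..<p (Suc j)}" for j
    using successive_interval_partition_unions[OF assms(6), of j] by (simp add: p_def assms(7))
  have "0 < n j" for j
    using assms(6) unfolding assms(7)[symmetric] successive_interval_partition_def by (simp add: card_gt_0_iff)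
  then interpret spreading_blocks p smul e
    by unfold_locales (auto simp: p_def strict_mono_Suc_iff assms(5))
  have \<sigma>: "\<sigma> j = block j" and width: "n j = width j" for j
    by (simp_all add: \<sigma>_eq block_def width_def p_def)
  define coeff where "coeff = basis_coeff smul e"
  define T where "T = averaging_term smul e \<sigma> n"
  define Q where "Q = averaging_op smul e \<sigma> n"
  have T: "T x j = smul (1 / of_nat (width j) * (\<Sum>i\<in>block j. coeff x i)) (\<Sum>i\<in>block j. e i)" for x j
    by (simp add: T_def coeff_def averaging_term_def \<sigma> width)
  \<comment> \<open>The expansion of \<open>x\<close> grouped into blocks; its partial sums are
    those of the expansion at the lengths \<open>p m\<close>, a subsequence.\<close>
  define B where "B x j = (\<Sum>i\<in>block j. smul (coeff x i) (e i))" for x j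
  have B_sums: "B x sums x" for x
  proof -
    have "(\<Sum>j<m. B x j) = (\<Sum>i<p m. smul (coeff x i) (e i))" for m
      unfolding B_def UN_block_lessThan[symmetric]
      by (rule sum.UNION_disjoint[symmetric]) (use block_disjoint in auto)
    moreover have "(\<lambda>m. \<Sum>i<p m. smul (coeff x i) (e i)) \<longlonglongrightarrow> x"
      using LIMSEQ_subseq_LIMSEQ[OF sums_basis_coeff[OF basis, unfolded sums_def] strict_mono_p, of x]
      by (simp add: o_def coeff_def)
    ultimately show ?thesis by (simp add: sums_def)
  qed
  have T_le: "norm (sum (T x) J) \<le> 3 * norm (sum (B x) J)" if "finite J" for x J
    using norm_averages_le[OF that] by (simp add: T B_def)
  \<comment> \<open>The estimate \<open>T_le\<close> transfers the Cauchy criterion from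
    \<open>B x\<close> to \<open>T x\<close>, with \<epsilon> / 3 absorbing the factor 3.\<close>
  have summable: "summable (T x)" for x
    unfolding summable_Cauchy
  proof (intro allI impI)
    fix \<epsilon> :: real
    assume "\<epsilon> > 0"
    then obtain N where "\<forall>m\<ge>N. \<forall>l. norm (sum (B x) {m..<l}) < \<epsilon> / 3"
      using sums_summable[OF B_sums, of x] unfolding summable_Cauchy
      by (metis zero_less_divide_iff zero_less_numeral)
    then have "norm (sum (T x) {m..<l}) < \<epsilon>" if "m \<ge> N" for m l
      using le_less_trans[OF T_le, of "{m..<l}" x \<epsilon>] that by (simp add: field_simps)
    then show "\<exists>N. \<forall>m\<ge>N. \<forall>l. norm (sum (T x) {m..<l}) < \<epsilon>" by blast
  qed
  have T_sums: "T x sums Q x" for x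
    using summable[of x] by (simp add: Q_def averaging_op_def T_def summable_sums)
  have Q_le: "norm (Q x) \<le> 3 * norm x" for x
  proof (rule LIMSEQ_le)
    show "(\<lambda>m. norm (sum (T x) {..<m})) \<longlonglongrightarrow> norm (Q x)"
      using T_sums by (simp add: sums_def tendsto_norm)
    show "(\<lambda>m. 3 * norm (sum (B x) {..<m})) \<longlonglongrightarrow> 3 * norm x"
      using B_sums by (intro tendsto_intros) (simp add: sums_def)
    show "\<exists>N. \<forall>m\<ge>N. norm (sum (T x) {..<m}) \<le> 3 * norm (sum (B x) {..<m})"
      using T_le by blast
  qed
  have T_add: "T (x + y) = (\<lambda>j. T x j + T y j)" for x y
    by (simp add: fun_eq_iff T coeff_def basis_coeff_add[OF vector_space_axioms basis] sum.distrib
        distrib_left add_divide_distrib scale_left_distrib)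
  have T_scale: "T (smul c x) = (\<lambda>j. smul c (T x j))" for c x
    by (simp add: fun_eq_iff mult.left_commute T coeff_def basis_coeff_scale[OF assms(1) basis] flip: sum_distrib_left)
  have Q_add: "Q (x + y) = Q x + Q y" for x y
    by (rule sums_unique2[OF T_sums[of "x + y", unfolded T_add] sums_add[OF T_sums T_sums]])
  have Q_scale: "Q (smul c x) = smul c (Q x)" for c x
    by (rule sums_unique2[OF T_sums[of "smul c x", unfolded T_scale]
          bounded_linear.sums[OF bounded_linear_scale T_sums]])
  have Q_linear: "Vector_Spaces.linear smul smul Q"
    by unfold_locales (simp_all add: Q_add Q_scale)
  have Q_bounded: "bounded_linear Q"
    \<comment> \<open>Real homogeneity is the case of scalars \<open>of_real r\<close>.\<close>
    by (rule bounded_linear_intro[where K = 3])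
      (use Q_add Q_scale[of "of_real _"] Q_le in \<open>auto simp: scale_of_real mult.commute\<close>)
  \<comment> \<open>The coefficients of a block sum are 1 on its block and 0 elsewhere, hence so are
    their averages.\<close>
  have Q_block: "Q (\<Sum>i\<in>block j. e i) = (\<Sum>i\<in>block j. e i)" for j
  proof -
    have "T (\<Sum>i\<in>block j. e i) = (\<lambda>l. if l = j then \<Sum>i\<in>block j. e i else 0)"
    proof
      fix l
      have "(\<Sum>i\<in>block l. coeff (\<Sum>i\<in>block j. e i) i) = of_nat (card (block l \<inter> block j))"
        by (simp add: coeff_def basis_coeff_sum[OF vector_space_axioms basis] flip: sum.inter_restrict)
      moreover have "card (block j) = width j" by (simp add: block_def width_def)
      ultimately show "T (\<Sum>i\<in>block j. e i) l = (if l = j then \<Sum>i\<in>block j. e i else 0)"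
        using width_pos[of j] block_disjoint[of l j] by (auto simp: T)
    qed
    then show ?thesis using T_sums[of "\<Sum>i\<in>block j. e i"] sums_single[of j "\<lambda>_. \<Sum>i\<in>block j. e i"]
      by (metis sums_unique2)
  qed
  \<comment> \<open>By continuity \<open>Q\<close> acts termwise on the series for
    \<open>Q x\<close>, and each term is a multiple of a block sum, which \<open>Q\<close>
    fixes.\<close>
  have "Q (Q x) = Q x" for x
  proof -
    have "(\<lambda>j. Q (T x j)) sums Q (Q x)" by (rule bounded_linear.sums[OF Q_bounded T_sums])
    moreover have "Q (T x j) = T x j" for j by (simp add: T Q_scale Q_block)
    ultimately show ?thesis using T_sums[of x] by (simp add: sums_unique2)
  qed
  then have "bounded_projection smul Q"
    using Q_linear Q_bounded by (auto simp: bounded_projection_def)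
  moreover have "onorm Q \<le> 3" by (rule onorm_bound) (simp_all add: Q_le)
  ultimately show ?thesis using summable by (simp add: Q_def T_def)
qed

end
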